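(* For each integer $n\ge 0$ let $a_n$ be the number of even Motzkin paths of length $n$, let $b_n$ be the number of odd Motzkin paths of length $n$, and let $s_n = a_n - b_n \in \mathbb{Z}$. Let $S(x)=\sum_{n\ge 0} s_n x^n = 1 + x - 2x^3 - 3x^4 + x^5+\cdots \in \mathbb{Z}[[x]]$. Then the reverse (compositional inverse) of the formal power series $xS(x)=\sum_{n\ge 0}s_n x^{n+1}$ is $$(xS(x))^{rev}=\sum_{n\ge 1} t(n)\,x^n = x - x^2 + 2x^3 - 3x^4 + 5x^5 - 8x^6 + 13x^7-\cdots,$$ where $t(0)=0$, $t(1)=1$ and $t(n)=-t(n-1)+t(n-2)$ for all $n>1$. Equivalently, $t(n) = (-1)^{n+1}F_n$ for all $n\ge 1$, where $F_n$ is the $n$-th Fibonacci number.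
   Context: A Motzkin path of length $n$ is a lattice path in $\mathbb{Z}^2$ from $(0,0)$ to $(n,0)$ consisting of $n$ steps, each of which is an up-step $U=(1,1)$, a down-step $D=(1,-1)$ or a horizontal step $H=(1,0)$, and which never goes below the $x$-axis. The empty path is the unique Motzkin path of length $0$. A Motzkin path is called even if its number of $U$ steps is even (zero counts as even), and odd otherwise. The numbers $s_n$ are called the shadows of the Motzkin numbers (OEIS A343773). For a formal power series $G(x)$ with zero constant term and invertible coefficient of $x$, its reverse $G(x)^{rev}$ is the unique formal power series $R(x)$ with zero constant term such that $G(R(x))=R(G(x))=x$. The Fibonacci numbers are $F_0=0$, $F_1=1$, $F_n=F_{n-1}+F_{n-2}$ for $n\ge 2$. *)

theory Defs
  imports
    "HOL-Computational_Algebra.Formal_Power_Series"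
    "HOL-Number_Theory.Fib"
    "HOL-Library.Product_Plus"
begin

datatype step = Up | Down | Horizontal

primrec step_vec :: "step \<Rightarrow> int \<times> int" where
  "step_vec Up = (1, 1)"
| "step_vec Down = (1, -1)"
| "step_vec Horizontal = (1, 0)"

text \<open>The lattice point reached from the origin after the first \<open>k\<close> steps of \<open>p\<close>.\<close>

definition vertex :: "step list \<Rightarrow> nat \<Rightarrow> int \<times> int" where
  "vertex p k = (\<Sum>s\<leftarrow>take k p. step_vec s)"

definition motzkin_paths :: "nat \<Rightarrow> step list set" where
  "motzkin_paths n =
     {p. length p = n \<and> vertex p n = (int n, 0) \<and> (\<forall>k\<le>n. snd (vertex p k) \<ge> 0)}"

lemma finite_motzkin_paths: "finite (motzkin_paths n)"
proof (rule finite_subset)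
  have UNIV_step: "(UNIV :: step set) = {Up, Down, Horizontal}"
    using step.exhaust by blast
  show "finite {p :: step list. set p \<subseteq> UNIV \<and> length p = n}"
    by (rule finite_lists_length_eq) (simp add: UNIV_step)
qed (auto simp: motzkin_paths_def)

definition even_motzkin_paths :: "nat \<Rightarrow> step list set" where
  "even_motzkin_paths n = {p \<in> motzkin_paths n. even (count_list p Up)}"

definition odd_motzkin_paths :: "nat \<Rightarrow> step list set" where
  "odd_motzkin_paths n = {p \<in> motzkin_paths n. odd (count_list p Up)}"

definition motzkin_shadow :: "nat \<Rightarrow> int" where
  "motzkin_shadow n = int (card (even_motzkin_paths n)) - int (card (odd_motzkin_paths n))"

definition shadow_fps :: "int fps" where
  "shadow_fps = Abs_fps motzkin_shadow"

text \<open>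
  The library's compositional inverse \<open>fps_inv\<close> divides by the linear coefficient and hence
  requires coefficients in a field. The following notion also makes sense over the integers.
\<close>

definition is_fps_reverse :: "'a::comm_ring_1 fps \<Rightarrow> 'a fps \<Rightarrow> bool" where
  "is_fps_reverse G R \<longleftrightarrow>
     fps_nth G 0 = 0 \<and> fps_nth G 1 dvd 1 \<and> fps_nth R 0 = 0 \<and>
     G oo R = fps_X \<and> R oo G = fps_X"

definition fps_reverse :: "'a::comm_ring_1 fps \<Rightarrow> 'a fps" where
  "fps_reverse G = (THE R. is_fps_reverse G R)"

lemma is_fps_reverse_unique:
  fixes G :: "'a::idom fps"
  assumes "is_fps_reverse G R" and "is_fps_reverse G R'"
  shows "R = R'"
proof -
  have "R = R oo (G oo R')"
    using assms(2) by (simp add: is_fps_reverse_def)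
  also have "\<dots> = (R oo G) oo R'"
    using assms by (intro fps_compose_assoc) (simp_all add: is_fps_reverse_def)
  also have "\<dots> = R'"
    using assms by (simp add: is_fps_reverse_def fps_X_fps_compose_startby0)
  finally show ?thesis .
qed

lemma fps_reverse_eqI:
  fixes G :: "'a::idom fps"
  assumes "is_fps_reverse G R"
  shows "fps_reverse G = R"
  unfolding fps_reverse_def using assms is_fps_reverse_unique by blast

end

theory Submission
  imports Defs
begin

text \<open>
  Weight a path by \<open>(-1)^u\<close>, where \<open>u\<close> is its number of up-steps, and let \<open>W h\<close> be the
  generating function of the nonnegative paths from height \<open>h\<close> down to height \<open>0\<close>. Splitting off the first step
  gives \<open>W h = [h = 0] + X * (W h - W (h + 1) + W (h - 1))\<close>, which determines \<open>W\<close>. If \<open>S\<close> is the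
  solution of \<open>S = 1 + X * S - X^2 * S^2\<close>, then \<open>X^h * S^(h + 1)\<close> satisfies these equations; hence
  \<open>W 0 = S\<close>, and \<open>G = X * S\<close> satisfies \<open>G = X * (1 + G - G^2)\<close>. Since the generating function of \<open>t\<close>
  is \<open>X / (1 + X - X^2)\<close>, it is the compositional inverse of \<open>G\<close>.
\<close>

lemma vertex_0 [simp]: "vertex p 0 = 0"
  by (simp add: vertex_def)

lemma vertex_Cons_Suc [simp]: "vertex (s # p) (Suc k) = step_vec s + vertex p k"
  by (simp add: vertex_def)

text \<open>Every step advances by one in the first coordinate, so the end point condition on a path
  only constrains its height.\<close>

lemma fst_vertex: "k \<le> length p \<Longrightarrow> fst (vertex p k) = int k"
proof (induction p arbitrary: k)
  case (Cons s p)
  then show ?case by (cases k; cases s) auto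
qed simp

text \<open>\<open>vertex\<close> measures displacement from the start, hence the added
  \<open>h\<close>. An integer \<open>h\<close> lets the step recurrence mention height
  \<open>h - 1\<close> even at \<open>h = 0\<close>.\<close>

definition descents :: "int \<Rightarrow> nat \<Rightarrow> step list set" where
  "descents h n =
     {p. length p = n \<and> h + snd (vertex p n) = 0 \<and> (\<forall>k\<le>n. h + snd (vertex p k) \<ge> 0)}"

lemma motzkin_paths_eq_descents: "motzkin_paths n = descents 0 n"
  by (auto simp: motzkin_paths_def descents_def fst_vertex prod_eq_iff)

lemma descents_neg: "h < 0 \<Longrightarrow> descents h n = {}"
  by (fastforce simp: descents_def)

lemma descents_0: "descents h 0 = (if h = 0 then {[]} else {})"
  by (auto simp: descents_def)

lemma Cons_in_descents_iff:
  assumes "h \<ge> 0"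
  shows "s # p \<in> descents h (Suc n) \<longleftrightarrow> p \<in> descents (h + snd (step_vec s)) n"
  using assms by (simp add: descents_def All_less_Suc2 add.assoc flip: less_Suc_eq_le)

lemma descents_Suc:
  assumes "h \<ge> 0"
  shows "descents h (Suc n) = (#) Up ` descents (h + 1) n
    \<union> ((#) Horizontal ` descents h n \<union> (#) Down ` descents (h - 1) n)"
proof (rule set_eqI)
  fix q
  show "q \<in> descents h (Suc n) \<longleftrightarrow> q \<in> (#) Up ` descents (h + 1) n
    \<union> ((#) Horizontal ` descents h n \<union> (#) Down ` descents (h - 1) n)"
  proof (cases q)
    case Nil
    then show ?thesis by (auto simp: descents_def)
  next
    case (Cons s p)
    then show ?thesis
      using Cons_in_descents_iff[OF assms, of s p n] by (cases s) auto
  qed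
qed

lemma finite_descents: "finite (descents h n)"
proof (induction n arbitrary: h)
  case (Suc n)
  then show ?case by (cases "h \<ge> 0") (auto simp: descents_Suc descents_neg)
qed (simp add: descents_0)

definition descent_weight :: "int \<Rightarrow> nat \<Rightarrow> int" where
  "descent_weight h n = (\<Sum>p\<in>descents h n. (- 1) ^ count_list p Up)"

lemma descent_weight_Suc:
  assumes "h \<ge> 0"
  shows "descent_weight h (Suc n)
    = descent_weight h n - descent_weight (h + 1) n + descent_weight (h - 1) n"
proof -
  have "descent_weight h (Suc n) = (\<Sum>p\<in>(#) Up ` descents (h + 1) n. (- 1) ^ count_list p Up)
      + ((\<Sum>p\<in>(#) Horizontal ` descents h n. (- 1) ^ count_list p Up)
      + (\<Sum>p\<in>(#) Down ` descents (h - 1) n. (- 1) ^ count_list p Up))"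
    unfolding descent_weight_def descents_Suc[OF assms]
    by (subst sum.union_disjoint; (subst sum.union_disjoint)?) (auto simp: finite_descents)
  \<comment> \<open>Prepending a step is injective, and only \<open>Up\<close> changes the count,
    which flips the sign.\<close>
  then show ?thesis
    by (simp add: sum.reindex descent_weight_def sum_negf)
qed

lemma motzkin_shadow_eq_descent_weight: "motzkin_shadow n = descent_weight 0 n"
proof -
  have split: "motzkin_paths n = even_motzkin_paths n \<union> odd_motzkin_paths n"
    by (auto simp: even_motzkin_paths_def odd_motzkin_paths_def)
  then have fin: "finite (even_motzkin_paths n)" "finite (odd_motzkin_paths n)"
    using finite_motzkin_paths[of n] by simp_all
  have "descent_weight 0 n = (\<Sum>p\<in>even_motzkin_paths n. (- 1) ^ count_list p Up)
      + (\<Sum>p\<in>odd_motzkin_paths n. (- 1) ^ count_list p Up)"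
    unfolding descent_weight_def motzkin_paths_eq_descents[symmetric] split
    using fin
    by (rule sum.union_disjoint) (auto simp: even_motzkin_paths_def odd_motzkin_paths_def)
  also have "\<dots> = motzkin_shadow n"
    by (simp add: motzkin_shadow_def even_motzkin_paths_def odd_motzkin_paths_def)
  finally show ?thesis by simp
qed

text \<open>The equation for \<open>S\<close> read off coefficientwise. For \<open>n = 0\<close> the
  sum is empty, so the truncated \<open>n - 1\<close> does no harm.\<close>

fun shadow_rec :: "nat \<Rightarrow> int" where
  "shadow_rec 0 = 1"
| "shadow_rec (Suc n) = shadow_rec n - (\<Sum>k<n. shadow_rec k * shadow_rec (n - 1 - k))"

lemma shadow_rec_fps_eq:
  defines "S \<equiv> Abs_fps shadow_rec"
  shows "S = 1 + fps_X * S - (fps_X * S) ^ 2"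
proof (rule fps_ext)
  fix n
  have sq: "(fps_X * S) ^ 2 = fps_X * (fps_X * (S * S))"
    by (simp add: power2_eq_square mult_ac)
  show "fps_nth S n = fps_nth (1 + fps_X * S - (fps_X * S) ^ 2) n"
  proof (cases n)
    case (Suc m)
    have "(\<Sum>k<m. shadow_rec k * shadow_rec (m - 1 - k)) = fps_nth (fps_X * (S * S)) m"
    proof (cases m)
      case (Suc l)
      have "fps_nth (S * S) l = (\<Sum>k\<le>l. shadow_rec k * shadow_rec (l - k))"
        by (simp add: S_def fps_mult_nth atLeast0AtMost)
      with Suc show ?thesis by (simp add: lessThan_Suc_atMost)
    qed simp
    then show ?thesis by (simp add: Suc sq) (simp add: S_def)
  qed (simp add: sq S_def)
qed

text \<open>Both sides have the same values at \<open>n = 0\<close> and obey the same recurrence in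
  \<open>n\<close>, which involves neighbouring heights; so \<open>h\<close> stays arbitrary in the
  induction.\<close>

lemma descent_weight_eq_coeff:
  defines "S \<equiv> Abs_fps shadow_rec"
  shows "descent_weight (int h) n = fps_nth ((fps_X * S) ^ h * S) n"
proof (induction n arbitrary: h)
  case 0
  then show ?case
    by (cases h) (simp_all add: descent_weight_def descents_0 S_def)
next
  case (Suc n)
  let ?G = "fps_X * S"
  have S: "S = 1 + ?G - ?G ^ 2"
    unfolding S_def by (rule shadow_rec_fps_eq)
  \<comment> \<open>This removes the \<open>Down\<close> term of the recurrence at height 0.\<close>
  have neg: "descent_weight (- 1) n = 0"
    by (simp add: descent_weight_def descents_neg)
  show ?case
  proof (cases h)
    case 0
    have S': "S = 1 + fps_X * (S - ?G * S)"
      by (subst S) (simp add: algebra_simps power2_eq_square)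
    have "fps_nth S (Suc n) = fps_nth S n - fps_nth (?G * S) n"
      by (subst S') simp
    then show ?thesis
      using Suc.IH[of 0] Suc.IH[of 1] neg by (simp add: 0 descent_weight_Suc)
  next
    case (Suc j)
    \<comment> \<open>One factor \<open>?G\<close> gives up its \<open>fps_X\<close> for the index
      shift; the \<open>S\<close> it leaves is expanded by the quadratic equation.\<close>
    have "?G ^ h * S = fps_X * (?G ^ j * S * S)"
      by (simp add: Suc mult_ac)
    also have "?G ^ j * S * S = ?G ^ j * S * (1 + ?G - ?G ^ 2)"
      using S by simp
    also have "\<dots> = ?G ^ j * S + ?G ^ h * S - ?G ^ Suc h * S"
      by (simp add: Suc algebra_simps power2_eq_square)
    finally have "fps_nth (?G ^ h * S) (Suc n)
        = fps_nth (fps_X * (?G ^ j * S + ?G ^ h * S - ?G ^ Suc h * S)) (Suc n)"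
      by (rule arg_cong)
    also have "\<dots> = fps_nth (?G ^ j * S) n + fps_nth (?G ^ h * S) n - fps_nth (?G ^ Suc h * S) n"
      by (simp del: power_Suc)
    finally have "fps_nth (?G ^ h * S) (Suc n)
        = fps_nth (?G ^ j * S) n + fps_nth (?G ^ h * S) n - fps_nth (?G ^ Suc h * S) n" .
    moreover have "int h + 1 = int (Suc h)" "int h - 1 = int j"
      using Suc by simp_all
    ultimately show ?thesis
      using Suc.IH by (simp only: descent_weight_Suc of_nat_0_le_iff)
  qed
qed

lemma motzkin_shadow_eq_rec: "motzkin_shadow = shadow_rec"
proof
  show "motzkin_shadow n = shadow_rec n" for n
    using descent_weight_eq_coeff[of 0 n] by (simp add: motzkin_shadow_eq_descent_weight)
qed

lemma shadow_fps_eq: "shadow_fps = 1 + fps_X * shadow_fps - (fps_X * shadow_fps) ^ 2"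
  using shadow_rec_fps_eq by (simp add: shadow_fps_def motzkin_shadow_eq_rec)

lemma is_fps_reverse_quadraticI:
  fixes G T :: "'a::idom fps"
  assumes G: "G = fps_X * (1 + G - G ^ 2)"
    and T: "fps_X = T * (1 + fps_X - fps_X ^ 2)"
  shows "is_fps_reverse G T"
proof -
  have G0: "fps_nth G 0 = 0"
    by (subst G) simp
  have G1: "fps_nth G 1 = 1"
    by (subst G) (simp add: G0 power2_eq_square)
  have "fps_nth (T * (1 + fps_X - fps_X ^ 2)) 0 = 0"
    unfolding T[symmetric] by simp
  then have T0: "fps_nth T 0 = 0"
    by (simp add: power2_eq_square)
  \<comment> \<open>Composing the equation for \<open>T\<close> with \<open>G\<close> gives
    \<open>T oo G\<close> times a series with constant term 1, which can be cancelled.\<close>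
  have "G = (T * (1 + fps_X - fps_X ^ 2)) oo G"
    unfolding T[symmetric] by (simp add: fps_X_fps_compose_startby0 G0)
  also have "\<dots> = (T oo G) * (1 + G - G ^ 2)"
    by (simp add: fps_compose_mult_distrib fps_compose_add_distrib fps_compose_sub_distrib
        fps_X_fps_compose_startby0 fps_compose_1 power2_eq_square G0)
  finally have "(T oo G) * (1 + G - G ^ 2) = fps_X * (1 + G - G ^ 2)"
    using G by simp
  moreover have "fps_nth (1 + G - G ^ 2) 0 \<noteq> 0"
    by (simp add: G0 power2_eq_square)
  then have "1 + G - G ^ 2 \<noteq> 0" by fastforce
  ultimately have TG: "T oo G = fps_X" by simp
  \<comment> \<open>Both \<open>Y\<close> and \<open>fps_X\<close> solve
    \<open>Z = T * (1 + Z - Z ^ 2)\<close>. The difference of the two equations has the factor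
    \<open>Y - fps_X\<close>, and its cofactor has constant term 1.\<close>
  define Y where "Y = G oo T"
  have "Y = (fps_X * (1 + G - G ^ 2)) oo T"
    unfolding Y_def G[symmetric] ..
  also have "\<dots> = T * (1 + Y - Y ^ 2)"
    by (simp add: Y_def fps_compose_mult_distrib fps_compose_add_distrib fps_compose_sub_distrib
        fps_X_fps_compose_startby0 fps_compose_1 power2_eq_square T0)
  finally have "Y - fps_X = T * (1 + Y - Y ^ 2) - T * (1 + fps_X - fps_X ^ 2)"
    using T by simp
  then have "(Y - fps_X) * (1 - T * (1 - Y - fps_X)) = 0"
    by (simp add: algebra_simps power2_eq_square)
  moreover have "fps_nth (1 - T * (1 - Y - fps_X)) 0 \<noteq> 0"
    by (simp add: T0)
  then have "1 - T * (1 - Y - fps_X) \<noteq> 0" by fastforce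
  ultimately have "Y = fps_X" by simp
  with TG show ?thesis
    by (simp add: is_fps_reverse_def G0 G1[unfolded One_nat_def] T0 Y_def)
qed

text \<open>Coefficients 0 and 1 encode the initial values, all later ones the recurrence. Clearing
  the denominator avoids division.\<close>

lemma signed_fib_fps:
  fixes t :: "nat \<Rightarrow> 'a::comm_ring_1"
  assumes "t 0 = 0" and "t 1 = 1" and "\<And>n. n > 1 \<Longrightarrow> t n = - t (n - 1) + t (n - 2)"
  shows "fps_X = Abs_fps t * (1 + fps_X - fps_X ^ 2)"
proof (rule fps_ext)
  fix n
  have eq: "Abs_fps t * (1 + fps_X - fps_X ^ 2)
      = Abs_fps t + fps_X * Abs_fps t - fps_X * (fps_X * Abs_fps t)"
    by (simp add: algebra_simps power2_eq_square)
  consider "n = 0" | "n = 1" | m where "n = Suc (Suc m)"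
    by (metis One_nat_def not0_implies_Suc)
  then show "fps_nth fps_X n = fps_nth (Abs_fps t * (1 + fps_X - fps_X ^ 2)) n"
    unfolding eq using assms(1,2) assms(3)[of n] by cases simp_all
qed

lemma signed_fib_eq:
  fixes t :: "nat \<Rightarrow> int"
  assumes "t 0 = 0" and "t 1 = 1" and "\<And>n. n > 1 \<Longrightarrow> t n = - t (n - 1) + t (n - 2)"
  shows "t n = (- 1) ^ (n + 1) * int (fib n)"
proof (induction n rule: fib.induct)
  case (3 n)
  then show ?case using assms(3)[of "Suc (Suc n)"] by (simp add: algebra_simps)
qed (use assms in simp_all)

theorem mainTheorem1:
  fixes t :: "nat \<Rightarrow> int"
  assumes t0: "t 0 = 0"
    and t1: "t 1 = 1"
    and t_rec: "\<And>n. n > 1 \<Longrightarrow> t n = - t (n - 1) + t (n - 2)"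
  shows "map (fps_nth shadow_fps) [0..<6] = [1, 1, 0, -2, -3, 1]
    \<and> is_fps_reverse (fps_X * shadow_fps) (Abs_fps t)
    \<and> fps_reverse (fps_X * shadow_fps) = Abs_fps t
    \<and> map t [0..<8] = [0, 1, -1, 2, -3, 5, -8, 13]
    \<and> (\<forall>n\<ge>1. t n = (-1) ^ (n + 1) * int (fib n))"
proof -
  have "is_fps_reverse (fps_X * shadow_fps) (Abs_fps t)"
  proof (rule is_fps_reverse_quadraticI)
    show "fps_X * shadow_fps
        = fps_X * (1 + fps_X * shadow_fps - (fps_X * shadow_fps) ^ 2)"
      using shadow_fps_eq by simp
    show "fps_X = Abs_fps t * (1 + fps_X - fps_X ^ 2)"
      using assms by (rule signed_fib_fps)
  qed
  \<comment> \<open>Rewriting to \<open>shadow_rec\<close> makes the coefficients computable by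
    simplification.\<close>
  moreover have "map (fps_nth shadow_fps) [0..<6] = [1, 1, 0, -2, -3, 1]"
    by (simp add: shadow_fps_def motzkin_shadow_eq_rec upt_rec eval_nat_numeral)
  moreover have fib: "t n = (- 1) ^ (n + 1) * int (fib n)" for n
    using assms by (rule signed_fib_eq)
  moreover have "map t [0..<8] = [0, 1, -1, 2, -3, 5, -8, 13]"
    by (simp add: fib upt_rec eval_nat_numeral)
  ultimately show ?thesis
    by (simp add: fps_reverse_eqI)
qed

end
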